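(* Let $r,s,n$ be positive integers, and let $a_{r,s}(n)$ be the number of permutations $\pi$ of $\{1,\dots,n\}$ such that $\pi_{i+r}-\pi_i\neq s$ for all $1\le i\le n-r$. Then $$a_{r,s}(n)=\sum_{\alpha} C^{(n,s)}_{\alpha}\cdot C^{(n,r)}_{\alpha}\cdot(-1)^{a_1+a_2+\cdots+a_n-n}\,a_1!\,a_2!\cdots a_n!,$$ where the sum ranges over all integer partitions $\alpha=1^{a_1}2^{a_2}\cdots n^{a_n}$ of $n$ written in frequency notation (so $1\cdot a_1+2\cdot a_2+\cdots+n\cdot a_n=n$), and $C^{(n,r)}_\alpha$, $C^{(n,s)}_\alpha$ are the tiling coefficients defined in the context.
   Context: A permutation $\pi$ of $\{1,\dots,n\}$ is written $\pi_1\pi_2\cdots\pi_n$. For a positive integer $r$, an $r$-tile is any translate (horizontal shift) of one of the sets $\{1\}$, $\{1,1+r\}$, $\{1,1+r,1+2r\}$, $\{1,1+r,1+2r,1+3r\}$, $\dots$, i.e. a set $\{m,m+r,\dots,m+(k-1)r\}$ with $k\ge 1$. An $r$-tiling of $\{1,\dots,n\}$ is a set partition of $\{1,\dots,n\}$ all of whose blocks are $r$-tiles. The weight of a tile $t$ is the variable $x_{\#t}$, the weight of a tiling is the product of the weights of its tiles, and $$f_{r,n}(x_1,\dots,x_n)=\sum_{T}\mathrm{weight}(T)=\sum_{\alpha}C^{(n,r)}_{\alpha}\,x_1^{a_1}x_2^{a_2}\cdots x_n^{a_n},$$ where $T$ ranges over all $r$-tilings of $\{1,\dots,n\}$ and $\alpha=1^{a_1}2^{a_2}\cdots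 n^{a_n}$ ranges over all integer partitions of $n$. Thus $C^{(n,r)}_\alpha$ is the number of $r$-tilings of $\{1,\dots,n\}$ having exactly $a_i$ tiles of size $i$ for each $i$; $C^{(n,s)}_\alpha$ is defined in the same way with $s$ in place of $r$. *)

theory Defs
  imports Complex_Main "HOL-Library.Disjoint_Sets" "HOL-Combinatorics.Permutations"
begin

definition is_tile :: "nat \<Rightarrow> nat set \<Rightarrow> bool" where
  "is_tile r t \<longleftrightarrow> (\<exists>m k. k \<ge> 1 \<and> t = (\<lambda>j. m + j * r) ` {..<k})"

definition tilings :: "nat \<Rightarrow> nat \<Rightarrow> nat set set set" where
  "tilings r n = {T. partition_on {1..n} T \<and> (\<forall>t\<in>T. is_tile r t)}"

text \<open>Integer partitions of \<open>n\<close> in frequency notation: \<open>a i\<close> is the number of parts equal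
  to \<open>i\<close>. Requiring \<open>a\<close> to vanish outside \<open>{1..n}\<close> makes the encoding unique.\<close>

definition int_partitions :: "nat \<Rightarrow> (nat \<Rightarrow> nat) set" where
  "int_partitions n = {a. (\<forall>i. i \<notin> {1..n} \<longrightarrow> a i = 0) \<and> (\<Sum>i=1..n. i * a i) = n}"

definition tiling_type :: "nat set set \<Rightarrow> nat \<Rightarrow> nat" where
  "tiling_type T i = card {t \<in> T. card t = i}"

definition tiling_coeff :: "nat \<Rightarrow> nat \<Rightarrow> (nat \<Rightarrow> nat) \<Rightarrow> nat" where
  "tiling_coeff n r a = card {T \<in> tilings r n. \<forall>i\<in>{1..n}. tiling_type T i = a i}"

definition avoiding_perms :: "nat \<Rightarrow> nat \<Rightarrow> nat \<Rightarrow> (nat \<Rightarrow> nat) set" where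
  "avoiding_perms r s n =
     {\<pi>. \<pi> permutes {1..n} \<and>
         (\<forall>i. 1 \<le> i \<and> i + r \<le> n \<longrightarrow> int (\<pi> (i + r)) - int (\<pi> i) \<noteq> int s)}"

lemma finite_avoiding_perms: "finite (avoiding_perms r s n)"
  by (rule finite_subset[OF _ finite_permutations[of "{1..n}"]]) (auto simp: avoiding_perms_def)

lemma finite_tilings: "finite (tilings r n)"
  by (rule finite_subset[of _ "Pow (Pow {1..n})"]) (auto simp: tilings_def partition_on_def)

lemma finite_int_partitions: "finite (int_partitions n)"
proof (rule finite_subset)
  show "int_partitions n \<subseteq> {a. \<forall>i. (i \<in> {1..n} \<longrightarrow> a i \<in> {..n}) \<and> (i \<notin> {1..n} \<longrightarrow> a i = 0)}"
  proof
    fix a assume a: "a \<in> int_partitions n"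
    have "a i \<in> {..n}" if i: "i \<in> {1..n}" for i
    proof -
      have "a i \<le> i * a i" using i by simp
      also have "\<dots> \<le> (\<Sum>i=1..n. i * a i)" using i by (intro member_le_sum) auto
      also have "\<dots> = n" using a by (simp add: int_partitions_def)
      finally show ?thesis by simp
    qed
    then show "a \<in> {a. \<forall>i. (i \<in> {1..n} \<longrightarrow> a i \<in> {..n}) \<and> (i \<notin> {1..n} \<longrightarrow> a i = 0)}"
      using a by (simp add: int_partitions_def)
  qed
  show "finite {a. \<forall>i. (i \<in> {1..n} \<longrightarrow> a i \<in> {..n}) \<and> (i \<notin> {1..n} \<longrightarrow> a i = (0::nat))}"
    by (rule finite_set_of_finite_funs) auto
qed

lemma tile_size: "T \<in> tilings r n \<Longrightarrow> t \<in> T \<Longrightarrow> finite t \<and> card t \<in> {1..n}"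
proof -
  assume T: "T \<in> tilings r n" and t: "t \<in> T"
  have sub: "t \<subseteq> {1..n}" and ne: "t \<noteq> {}"
    using T t by (auto simp: tilings_def partition_on_def)
  have fin: "finite t" using sub finite_subset by blast
  moreover have "card t \<le> n" using card_mono[OF _ sub] by simp
  moreover have "card t \<noteq> 0" using fin ne by simp
  ultimately show ?thesis by (simp add: Suc_le_eq card_gt_0_iff)
qed

lemma tiling_finite: "T \<in> tilings r n \<Longrightarrow> finite T"
  by (rule finite_subset[of _ "Pow {1..n}"]) (auto simp: tilings_def partition_on_def)

lemma tiling_type_in_int_partitions:
  assumes T: "T \<in> tilings r n"
  shows "tiling_type T \<in> int_partitions n"
proof -
  note size = tile_size[OF T] and fin = tiling_finite[OF T]
  have "(\<Sum>i=1..n. i * tiling_type T i) = (\<Sum>i=1..n. \<Sum>t\<in>{t\<in>T. card t = i}. card t)"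
    by (simp add: tiling_type_def mult.commute)
  also have "\<dots> = (\<Sum>t\<in>T. card t)"
    using size fin by (intro sum.group) auto
  also have "\<dots> = card (\<Union>T)"
    using T size by (subst card_Union_disjoint) (auto simp: tilings_def partition_on_def)
  also have "\<dots> = n" using T by (simp add: tilings_def partition_on_def)
  finally have "(\<Sum>i=1..n. i * tiling_type T i) = n" .
  moreover have "tiling_type T i = 0" if "i \<notin> {1..n}" for i
  proof -
    have "{t \<in> T. card t = i} = {}" using size that by blast
    then show ?thesis by (simp only: tiling_type_def card.empty)
  qed
  ultimately show ?thesis by (simp add: int_partitions_def)
qed

text \<open>The generating function \<open>f\<^sub>r\<^sub>,\<^sub>n(x\<^sub>1, \<dots>, x\<^sub>n)\<close> of tilings by weight, whose coefficients are
  the numbers \<open>tiling_coeff n r a\<close>.\<close>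

definition tiling_gf :: "nat \<Rightarrow> nat \<Rightarrow> (nat \<Rightarrow> 'a) \<Rightarrow> 'a::comm_semiring_1" where
  "tiling_gf r n x = (\<Sum>T\<in>tilings r n. \<Prod>t\<in>T. x (card t))"

lemma tiling_gf_eq:
  "tiling_gf r n x =
     (\<Sum>a\<in>int_partitions n. of_nat (tiling_coeff n r a) * (\<Prod>i=1..n. x i ^ a i))"
proof -
  have weight: "(\<Prod>t\<in>T. x (card t)) = (\<Prod>i=1..n. x i ^ tiling_type T i)"
    if T: "T \<in> tilings r n" for T
  proof -
    have "(\<Prod>i=1..n. x i ^ tiling_type T i) = (\<Prod>i=1..n. \<Prod>t\<in>{t\<in>T. card t = i}. x (card t))"
      by (simp add: tiling_type_def)
    also have "\<dots> = (\<Prod>t\<in>T. x (card t))"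
      using tile_size[OF T] tiling_finite[OF T] by (intro prod.group) auto
    finally show ?thesis by simp
  qed
  have type: "{T \<in> tilings r n. \<forall>i\<in>{1..n}. tiling_type T i = a i} =
      {T \<in> tilings r n. tiling_type T = a}" if a: "a \<in> int_partitions n" for a
  proof -
    have "tiling_type T = a" if "T \<in> tilings r n" "\<forall>i\<in>{1..n}. tiling_type T i = a i" for T
    proof
      fix i
      show "tiling_type T i = a i"
        using that a tiling_type_in_int_partitions[of T r n]
        by (cases "i \<in> {1..n}") (auto simp only: int_partitions_def mem_Collect_eq)
    qed
    then show ?thesis by auto
  qed
  have "tiling_gf r n x = (\<Sum>T\<in>tilings r n. \<Prod>i=1..n. x i ^ tiling_type T i)"
    unfolding tiling_gf_def by (intro sum.cong refl weight)
  also have "\<dots> = (\<Sum>a\<in>int_partitions n. \<Sum>T\<in>{T \<in> tilings r n. tiling_type T = a}.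
      \<Prod>i=1..n. x i ^ tiling_type T i)"
    using tiling_type_in_int_partitions
    by (intro sum.group[symmetric] finite_tilings finite_int_partitions) blast
  also have "\<dots> = (\<Sum>a\<in>int_partitions n. of_nat (tiling_coeff n r a) * (\<Prod>i=1..n. x i ^ a i))"
    by (intro sum.cong refl) (simp add: tiling_coeff_def type del: One_nat_def)
  finally show ?thesis .
qed

end

theory Submission
  imports Defs
begin

text \<open>The proof is inclusion--exclusion over the positions at which the forbidden difference
  occurs, with tilings as the bookkeeping device.

  Writing \<open>steps r n\<close> for the positions \<open>i\<close> with \<open>i\<close> and \<open>i + r\<close> both in \<open>{1..n}\<close>,
  the number of avoiding permutations is the alternating sum over \<open>S \<subseteq> steps r n\<close> of the number of
  permutations with \<open>\<pi> (i + r) = \<pi> i + s\<close> for all \<open>i \<in> S\<close> (lemma \<open>card_avoiding_perms\<close>).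
  Joining \<open>i\<close> to \<open>i + r\<close> for every \<open>i \<in> S\<close> cuts \<open>{1..n}\<close> into arithmetic progressions of
  difference \<open>r\<close>, so the sets \<open>S\<close> are the same thing as the \<open>r\<close>-tilings
  (lemma \<open>bij_betw_links\<close>). A tile of size \<open>k\<close> uses \<open>k - 1\<close> links, so a tiling \<open>T\<close> comes with the
  sign \<open>(-1)^(n - card T)\<close> (lemma \<open>card_links\<close>).

  Now fix \<open>T\<close>. A permutation satisfying the equations for the links of \<open>T\<close> sends each tile, in
  increasing order, to an \<open>s\<close>-tile of the same size; the images form an \<open>s\<close>-tiling \<open>U\<close> of the same
  type. Conversely, \<open>U\<close> together with a size-preserving bijection from \<open>T\<close> to \<open>U\<close> determines the
  permutation (lemma \<open>bij_betw_perms_tile_maps\<close>). If the type is \<open>a\<close>, there are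
  \<open>a 1! * \<dots> * a n!\<close> such bijections (lemma \<open>card_class_preserving_injections\<close>). Collecting the
  tilings \<open>T\<close> by type gives the formula.\<close>

section \<open>Tiles\<close>

definition chain :: "nat \<Rightarrow> nat \<Rightarrow> nat \<Rightarrow> nat set" where
  "chain r m k = (\<lambda>j. m + j * r) ` {..<k}"

lemma is_tile_chain: "is_tile r t \<longleftrightarrow> (\<exists>m k. k \<ge> 1 \<and> t = chain r m k)"
  by (simp add: is_tile_def chain_def)

lemma Min_chain: "k \<ge> 1 \<Longrightarrow> Min (chain r m k) = m"
  by (rule Min_eqI) (auto simp: chain_def intro!: image_eqI[of _ _ 0])

lemma card_chain: "r \<ge> 1 \<Longrightarrow> card (chain r m k) = k"
  unfolding chain_def by (subst card_image) (auto simp: inj_on_def)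

lemma tile_eq_chain:
  assumes "is_tile r t" "r \<ge> 1"
  shows "t = chain r (Min t) (card t)" and "card t \<ge> 1"
proof -
  obtain m k where "k \<ge> 1" "t = chain r m k"
    using assms by (auto simp: is_tile_chain)
  then show "t = chain r (Min t) (card t)" "card t \<ge> 1"
    using assms by (auto simp: Min_chain card_chain)
qed

lemma chain_memI: "j < k \<Longrightarrow> m + j * r \<in> chain r m k"
  by (auto simp: chain_def)

lemma chain_memE:
  assumes "x \<in> chain r m k"
  obtains j where "j < k" "x = m + j * r"
  using assms by (auto simp: chain_def)

text \<open>Only the last element of a tile has no successor in the tile. Everything about links rests on
  this.\<close>

lemma chain_succ_iff:
  assumes "r \<ge> 1" "j < k"
  shows "m + j * r + r \<in> chain r m k \<longleftrightarrow> Suc j < k"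
proof -
  have "m + j * r + r = m + i * r \<longleftrightarrow> i = Suc j" for i
  proof -
    have "m + j * r + r = m + i * r \<longleftrightarrow> Suc j * r = i * r" by auto
    also have "\<dots> \<longleftrightarrow> i = Suc j" using assms(1) by (subst mult_cancel2) auto
    finally show ?thesis .
  qed
  then show ?thesis by (auto simp: chain_def image_iff)
qed

section \<open>Tilings as sets of links\<close>

text \<open>A link is recorded by its left end, so a tiling is encoded by the set of non-maximal elements of
  its tiles.\<close>

definition links :: "nat \<Rightarrow> nat set set \<Rightarrow> nat set" where
  "links r T = {i. \<exists>t\<in>T. i \<in> t \<and> i + r \<in> t}"

definition steps :: "nat \<Rightarrow> nat \<Rightarrow> nat set" where
  "steps r n = {i. 1 \<le> i \<and> i + r \<le> n}"

lemma finite_steps: "finite (steps r n)"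
  by (rule finite_subset[of _ "{..n}"]) (auto simp: steps_def)

lemma tilingsD:
  assumes "T \<in> tilings r n"
  shows "\<And>t. t \<in> T \<Longrightarrow> t \<subseteq> {1..n}" "\<And>t. t \<in> T \<Longrightarrow> is_tile r t"
    "\<And>x. x \<in> {1..n} \<Longrightarrow> \<exists>t\<in>T. x \<in> t"
    "\<And>t u x. t \<in> T \<Longrightarrow> u \<in> T \<Longrightarrow> x \<in> t \<Longrightarrow> x \<in> u \<Longrightarrow> t = u"
    "\<And>t. t \<in> T \<Longrightarrow> t \<noteq> {}"
  using assms unfolding tilings_def partition_on_def disjoint_def by blast+

lemma tilingsI:
  assumes "\<And>t. t \<in> T \<Longrightarrow> t \<subseteq> {1..n}" "\<And>t. t \<in> T \<Longrightarrow> is_tile r t"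
    "\<And>x. x \<in> {1..n} \<Longrightarrow> \<exists>t\<in>T. x \<in> t"
    "\<And>t u x. t \<in> T \<Longrightarrow> u \<in> T \<Longrightarrow> x \<in> t \<Longrightarrow> x \<in> u \<Longrightarrow> t = u"
  shows "T \<in> tilings r n"
proof -
  have "t \<noteq> {}" if t: "t \<in> T" for t
  proof -
    obtain m k where "k \<ge> 1" "t = chain r m k"
      using assms(2)[OF t] unfolding is_tile_chain by blast
    then have "m \<in> t" using chain_memI[of 0 k m r] by simp
    then show ?thesis by blast
  qed
  then have "{} \<notin> T" by blast
  have "partition_on {1..n} T"
  proof (rule partition_onI)
    show "{} \<notin> T" by fact
    show "\<Union>T = {1..n}"
    proof
      show "\<Union>T \<subseteq> {1..n}" using assms(1) by (rule Union_least)
      show "{1..n} \<subseteq> \<Union>T" using assms(3) by (meson UnionI subsetI)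
    qed
    show "disjnt p q" if "p \<in> T" "q \<in> T" "p \<noteq> q" for p q
      using assms(4)[OF that(1,2)] that(3) by (auto simp: disjnt_iff)
  qed
  then show ?thesis unfolding tilings_def using assms(2) by (intro CollectI conjI ballI)
qed

lemma sum_tiling_type:
  assumes "T \<in> tilings r n"
  shows "(\<Sum>i=1..n. tiling_type T i) = card T"
proof -
  have "(\<Sum>i\<in>{1..n}. \<Sum>t\<in>{t\<in>T. card t = i}. (1::nat)) = (\<Sum>t\<in>T. 1)"
    using tiling_finite[OF assms] tile_size[OF assms] by (intro sum.group) auto
  then show ?thesis by (simp add: tiling_type_def)
qed

lemma links_subset_steps: "T \<in> tilings r n \<Longrightarrow> links r T \<subseteq> steps r n"
  using tilingsD(1)[of T r n] by (fastforce simp: links_def steps_def)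

lemma links_chain:
  assumes "r \<ge> 1"
  shows "{i \<in> chain r m k. i + r \<in> chain r m k} = chain r m (k - 1)"
proof -
  have "x \<in> {i \<in> chain r m k. i + r \<in> chain r m k} \<longleftrightarrow> x \<in> chain r m (k - 1)" for x
  proof
    assume x: "x \<in> {i \<in> chain r m k. i + r \<in> chain r m k}"
    then obtain j where j: "j < k" "x = m + j * r" by (auto elim: chain_memE)
    then have "Suc j < k" using x chain_succ_iff[OF assms j(1)] by blast
    then show "x \<in> chain r m (k - 1)" using j(2) by (auto intro: chain_memI)
  next
    assume "x \<in> chain r m (k - 1)"
    then obtain j where j: "j < k - 1" "x = m + j * r" by (auto elim: chain_memE)
    then show "x \<in> {i \<in> chain r m k. i + r \<in> chain r m k}"
      using chain_succ_iff[OF assms, of j k m] chain_memI[of j k m r] by auto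
  qed
  then show ?thesis by blast
qed

lemma card_links:
  assumes T: "T \<in> tilings r n" and r: "r \<ge> 1"
  shows "card (links r T) + card T = n"
proof -
  have tile: "card {i\<in>t. i + r \<in> t} + 1 = card t" if "t \<in> T" for t
  proof -
    note c = tile_eq_chain[OF tilingsD(2)[OF T that] r]
    have "{i\<in>t. i + r \<in> t} = chain r (Min t) (card t - 1)"
      using links_chain[OF r, of "Min t" "card t"] by (simp flip: c(1))
    then show ?thesis using c(2) by (simp add: card_chain[OF r])
  qed
  have "links r T = (\<Union>t\<in>T. {i\<in>t. i + r \<in> t})"
    by (auto simp: links_def)
  also have "card \<dots> = (\<Sum>t\<in>T. card {i\<in>t. i + r \<in> t})"
  proof (rule card_UN_disjoint)
    show "\<forall>t\<in>T. finite {i\<in>t. i + r \<in> t}" using tile_size[OF T] by simp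
    show "\<forall>t\<in>T. \<forall>u\<in>T. t \<noteq> u \<longrightarrow> {i\<in>t. i + r \<in> t} \<inter> {i\<in>u. i + r \<in> u} = {}"
      using tilingsD(4)[OF T] by blast
  qed (rule tiling_finite[OF T])
  finally have "card (links r T) + card T = (\<Sum>t\<in>T. card {i\<in>t. i + r \<in> t} + 1)"
    by (simp add: sum.distrib del: add_Suc_right Suc_eq_plus1 flip: One_nat_def)
  also have "\<dots> = (\<Sum>t\<in>T. card t)"
    using tile by (intro sum.cong) auto
  also have "\<dots> = card (\<Union>T)"
    using T tile_size[OF T] by (subst card_Union_disjoint) (auto simp: tilings_def partition_on_def)
  also have "\<dots> = n" using T by (simp add: tilings_def partition_on_def)
  finally show ?thesis .
qed

text \<open>Follow a tile of \<open>T\<close> from its minimum: every step to the next element is a link of \<open>T\<close>, hence of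
  \<open>U\<close>, and so stays in the block of \<open>U\<close> where the walk began. Using inclusion rather than equality
  of link sets yields injectivity of \<open>links\<close> by refining in both directions.\<close>

lemma refines_if_links_subset:
  assumes T: "T \<in> tilings r n" and U: "U \<in> tilings r n" and r: "r \<ge> 1"
    and sub: "links r T \<subseteq> links r U" and t: "t \<in> T"
  shows "\<exists>u\<in>U. t \<subseteq> u"
proof -
  note c = tile_eq_chain[OF tilingsD(2)[OF T t] r]
  have mem: "Min t + j * r \<in> t" if "j < card t" for j
    using chain_memI[OF that, of "Min t" r] by (simp flip: c(1))
  have "Min t \<in> {1..n}"
    using mem[of 0] c(2) tilingsD(1)[OF T t] by auto
  then obtain u where u: "u \<in> U" "Min t \<in> u" using tilingsD(3)[OF U] by blast
  have "Min t + j * r \<in> u" if "j < card t" for j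
    using that
  proof (induction j)
    case 0
    then show ?case using u by simp
  next
    case (Suc j)
    have "Min t + j * r \<in> links r T"
      using mem[of j] mem[of "Suc j"] Suc.prems t by (auto simp: links_def algebra_simps)
    then obtain u' where "u' \<in> U" "Min t + j * r \<in> u'" "Min t + j * r + r \<in> u'"
      using sub by (auto simp: links_def)
    moreover have "Min t + j * r \<in> u" using Suc by simp
    ultimately show ?case using tilingsD(4)[OF U] u(1) by (metis add.assoc add.commute mult_Suc)
  qed
  then have "chain r (Min t) (card t) \<subseteq> u" by (auto simp: chain_def)
  then show ?thesis using u(1) c(1) by auto
qed

lemma links_determine_tiling:
  assumes T: "T \<in> tilings r n" and U: "U \<in> tilings r n" and r: "r \<ge> 1"
    and eq: "links r T = links r U"
  shows "T = U"
proof -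
  have "T \<subseteq> U" if T: "T \<in> tilings r n" and U: "U \<in> tilings r n"
    and eq: "links r T = links r U" for T U
  proof
    fix t assume t: "t \<in> T"
    then obtain u where u: "u \<in> U" "t \<subseteq> u"
      using refines_if_links_subset[OF T U r _ t] eq by auto
    then obtain t' where t': "t' \<in> T" "u \<subseteq> t'"
      using refines_if_links_subset[OF U T r _ u(1)] eq by auto
    have "t = t'"
      using tilingsD(4,5)[OF T] t t'(1) u(2) t'(2) by blast
    then show "t \<in> U" using u t' by auto
  qed
  from this[OF T U eq] this[OF U T eq[symmetric]] show ?thesis by blast
qed

text \<open>The inverse of \<open>links\<close>: the maximal progressions all of whose steps lie in \<open>S\<close>. The start \<open>m\<close> has
  no predecessor in \<open>S\<close>, and the last element does not lie in \<open>S\<close>.\<close>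

definition maximal_chains :: "nat \<Rightarrow> nat \<Rightarrow> nat set \<Rightarrow> nat set set" where
  "maximal_chains r n S = {t. \<exists>m k. k \<ge> 1 \<and> t = chain r m k \<and> m \<in> {1..n} \<and>
     (\<forall>i\<in>S. i + r \<noteq> m) \<and> (\<forall>j. Suc j < k \<longrightarrow> m + j * r \<in> S) \<and> m + (k - 1) * r \<notin> S}"

text \<open>Walk back along \<open>S\<close> until a start is reached; from there the chain extends until it first leaves
  \<open>S\<close>, which must happen because \<open>S\<close> contains no position beyond \<open>n\<close>.\<close>

lemma maximal_chains_cover:
  assumes S: "S \<subseteq> steps r n" and r: "r \<ge> 1" and x: "x \<in> {1..n}"
  shows "\<exists>t\<in>maximal_chains r n S. x \<in> t"
  using x
proof (induction x rule: less_induct)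
  case (less x)
  show ?case
  proof (cases "\<exists>i\<in>S. i + r = x")
    case True
    then obtain i where i: "i \<in> S" "i + r = x" by blast
    then have "i < x" "i \<in> {1..n}" using S r by (auto simp: steps_def)
    then obtain t where t: "t \<in> maximal_chains r n S" "i \<in> t" using less.IH by blast
    then obtain m k where mk: "k \<ge> 1" "t = chain r m k" "m + (k - 1) * r \<notin> S"
      by (auto simp: maximal_chains_def)
    from t(2) obtain j where j: "j < k" "i = m + j * r" unfolding mk(2) by (rule chain_memE)
    have "j \<noteq> k - 1" using mk(3) i(1) j(2) by auto
    then have "x \<in> t"
      using chain_succ_iff[OF r j(1), of m] i(2) j mk(2) by auto
    then show ?thesis using t(1) by blast
  next
    case False
    define k where "k = (LEAST k. x + k * r \<notin> S)"
    have "x + n * r \<notin> S"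
    proof
      assume "x + n * r \<in> S"
      then have "x + n * r + r \<le> n" using S by (auto simp: steps_def)
      moreover have "n \<le> n * r" using r by simp
      ultimately show False using less.prems by (simp only: atLeastAtMost_iff) linarith
    qed
    then have "x + k * r \<notin> S" unfolding k_def by (rule LeastI)
    moreover have "x + j * r \<in> S" if "j < k" for j
      using not_less_Least[of j "\<lambda>k. x + k * r \<notin> S"] that unfolding k_def by blast
    ultimately have "chain r x (Suc k) \<in> maximal_chains r n S"
      unfolding maximal_chains_def mem_Collect_eq
      using False less.prems by (intro exI[of _ x] exI[of _ "Suc k"]) auto
    then show ?thesis using chain_memI[of 0 "Suc k" x r] by auto
  qed
qed

lemma maximal_chains_disjoint:
  assumes "t \<in> maximal_chains r n S" "u \<in> maximal_chains r n S" "x \<in> t" "x \<in> u"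
  shows "t = u"
proof -
  obtain m k where t: "k \<ge> 1" "t = chain r m k" "\<forall>i\<in>S. i + r \<noteq> m"
    "\<forall>j. Suc j < k \<longrightarrow> m + j * r \<in> S" "m + (k - 1) * r \<notin> S"
    using assms(1) by (auto simp: maximal_chains_def)
  obtain m' k' where u: "k' \<ge> 1" "u = chain r m' k'" "\<forall>i\<in>S. i + r \<noteq> m'"
    "\<forall>j. Suc j < k' \<longrightarrow> m' + j * r \<in> S" "m' + (k' - 1) * r \<notin> S"
    using assms(2) by (auto simp: maximal_chains_def)
  obtain i where i: "i < k" "x = m + i * r" using assms(3) t(2) by (auto elim: chain_memE)
  obtain j where j: "j < k'" "x = m' + j * r" using assms(4) u(2) by (auto elim: chain_memE)
  \<comment> \<open>A strictly earlier start would put the predecessor of the later start into \<open>S\<close>.\<close>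
  have start: "\<not> i < j" if "i < k" "j < k'" "m + i * r = m' + j * r"
    "\<forall>i\<in>S. i + r \<noteq> m" "\<forall>j. Suc j < k' \<longrightarrow> m' + j * r \<in> S" for m m' k k' i j
  proof
    assume ij: "i < j"
    then obtain d where d: "j = i + Suc d" using less_iff_Suc_add by auto
    have "m = m' + d * r + r" using that(3) d by (simp add: algebra_simps)
    moreover have "m' + d * r \<in> S" using that(2,5) d by auto
    ultimately show False using that(4) by blast
  qed
  have "i = j"
    using start[OF i(1) j(1) _ t(3) u(4)] start[OF j(1) i(1) _ u(3) t(4)] i(2) j(2) by auto
  then have m: "m = m'" using i j by auto
  have "\<not> k < k'" using t(1,5) u(4) m by auto
  moreover have "\<not> k' < k" using u(1,5) t(4) m by auto
  ultimately show ?thesis using m t(2) u(2) by auto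
qed

lemma maximal_chains_tiling:
  assumes S: "S \<subseteq> steps r n" and r: "r \<ge> 1"
  shows "maximal_chains r n S \<in> tilings r n"
proof (rule tilingsI)
  fix t assume "t \<in> maximal_chains r n S"
  then show "is_tile r t" by (auto simp: maximal_chains_def is_tile_chain)
next
  fix t assume "t \<in> maximal_chains r n S"
  then obtain m k where t: "k \<ge> 1" "t = chain r m k" "m \<in> {1..n}"
    "\<forall>j. Suc j < k \<longrightarrow> m + j * r \<in> S" by (auto simp: maximal_chains_def)
  have "m + j * r \<in> {1..n}" if "j < k" for j
  proof (cases j)
    case (Suc i)
    then have "m + i * r \<in> steps r n" using that t(4) S by auto
    then show ?thesis using Suc by (auto simp: steps_def algebra_simps)
  qed (use t in auto)
  then show "t \<subseteq> {1..n}" unfolding t(2) by (auto elim!: chain_memE)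
next
  show "\<exists>t\<in>maximal_chains r n S. x \<in> t" if "x \<in> {1..n}" for x
    by (rule maximal_chains_cover[OF S r that])
  show "t = u" if "t \<in> maximal_chains r n S" "u \<in> maximal_chains r n S" "x \<in> t" "x \<in> u"
    for t u x
    by (rule maximal_chains_disjoint[OF that])
qed

lemma links_maximal_chains:
  assumes S: "S \<subseteq> steps r n" and r: "r \<ge> 1"
  shows "links r (maximal_chains r n S) = S"
proof (intro equalityI subsetI)
  fix i assume "i \<in> links r (maximal_chains r n S)"
  then obtain t where "t \<in> maximal_chains r n S" and it: "i \<in> t" "i + r \<in> t"
    unfolding links_def by blast
  then obtain m k where mk: "t = chain r m k" "\<forall>j. Suc j < k \<longrightarrow> m + j * r \<in> S"
    unfolding maximal_chains_def by blast
  from it mk(1) have t: "i \<in> chain r m k" "i + r \<in> chain r m k" by auto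
  from t(1) obtain j where "j < k" "i = m + j * r" by (rule chain_memE)
  then show "i \<in> S" using chain_succ_iff[OF r, of j k m] t(2) mk(2) by auto
next
  fix i assume i: "i \<in> S"
  then have "i \<in> {1..n}" using S by (auto simp: steps_def)
  then obtain t where t: "t \<in> maximal_chains r n S" "i \<in> t"
    using maximal_chains_cover[OF S r] by blast
  then obtain m k where mk: "t = chain r m k" "m + (k - 1) * r \<notin> S"
    by (auto simp: maximal_chains_def)
  from t(2) obtain j where j: "j < k" "i = m + j * r" unfolding mk(1) by (rule chain_memE)
  have "j \<noteq> k - 1" using mk(2) i j(2) by auto
  then have "i + r \<in> t" using chain_succ_iff[OF r j(1), of m] j mk(1) by auto
  then show "i \<in> links r (maximal_chains r n S)" using t by (auto simp: links_def)
qed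

lemma bij_betw_links:
  assumes r: "r \<ge> 1"
  shows "bij_betw (links r) (tilings r n) (Pow (steps r n))"
  unfolding bij_betw_def
proof (intro conjI inj_onI subset_antisym[of "links r ` _"] subsetI)
  show "T = U" if "T \<in> tilings r n" "U \<in> tilings r n" "links r T = links r U" for T U
    using links_determine_tiling[OF that(1,2) r that(3)] .
  show "S \<in> Pow (steps r n)" if "S \<in> links r ` tilings r n" for S
    using that links_subset_steps by auto
  show "S \<in> links r ` tilings r n" if "S \<in> Pow (steps r n)" for S
    using that r by (intro image_eqI[of _ _ "maximal_chains r n S"])
      (auto simp: maximal_chains_tiling links_maximal_chains)
qed

section \<open>Counting size-preserving bijections\<close>

lemma card_injections_eq_fact:
  assumes "finite A" "finite B" "card A = card B"
  shows "card {f \<in> A \<rightarrow>\<^sub>E B. inj_on f A} = fact (card A)"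
proof -
  have "card {f \<in> A \<rightarrow>\<^sub>E B. inj_on f A} = (\<Prod>i = 0..<card A. card A - i)"
    unfolding card_inj_on_subset_funcset[OF assms(1,2) subset_refl] assms(3) by simp
  also have "\<dots> = fact (card A)" by (simp only: fact_prod_rev of_nat_id)
  finally show ?thesis .
qed

text \<open>An injection that preserves classes is an independent choice of one injection per class. Classes
  of equal size make these injections bijections, \<open>fact (card {x\<in>A. c x = i})\<close> of them in
  class \<open>i\<close>. With \<open>c = d = card\<close> on two tilings this counts the ways to match tiles of equal size.\<close>

lemma card_class_preserving_injections:
  assumes A: "finite A" and B: "finite B" and I: "finite I" "c ` A \<subseteq> I"
    and eq: "\<And>i. i \<in> I \<Longrightarrow> card {x\<in>A. c x = i} = card {y\<in>B. d y = i}"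
  shows "card {f \<in> PiE A (\<lambda>x. {y\<in>B. d y = c x}). inj_on f A} =
    (\<Prod>i\<in>I. fact (card {x\<in>A. c x = i}))"
proof -
  let ?A = "\<lambda>i. {x\<in>A. c x = i}" and ?B = "\<lambda>i. {y\<in>B. d y = i}"
  let ?G = "\<Pi>\<^sub>E i\<in>I. {f \<in> ?A i \<rightarrow>\<^sub>E ?B i. inj_on f (?A i)}"
  let ?F = "{f \<in> PiE A (\<lambda>x. {y\<in>B. d y = c x}). inj_on f A}"
  have "bij_betw (\<lambda>f. \<lambda>i\<in>I. restrict f (?A i)) ?F ?G"
  proof (rule bij_betw_byWitness[where f' = "\<lambda>g. \<lambda>x\<in>A. g (c x) x"])
    show "\<forall>f\<in>?F. (\<lambda>x\<in>A. (\<lambda>i\<in>I. restrict f (?A i)) (c x) x) = f"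
    proof
      fix f assume "f \<in> ?F"
      then have "f \<in> extensional A" by (simp add: PiE_def)
      then show "(\<lambda>x\<in>A. (\<lambda>i\<in>I. restrict f (?A i)) (c x) x) = f"
        using I(2) by (intro extensionalityI[of _ A]) auto
    qed
    show "\<forall>g\<in>?G. (\<lambda>i\<in>I. restrict (\<lambda>x\<in>A. g (c x) x) (?A i)) = g"
    proof
      fix g assume g: "g \<in> ?G"
      have "restrict (\<lambda>x\<in>A. g (c x) x) (?A i) = g i" if "i \<in> I" for i
      proof -
        have "g i \<in> extensional (?A i)" using PiE_mem[OF g that] by (simp add: PiE_def)
        then show ?thesis by (intro extensionalityI[of _ "?A i"]) auto
      qed
      then show "(\<lambda>i\<in>I. restrict (\<lambda>x\<in>A. g (c x) x) (?A i)) = g"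
        using g by (intro extensionalityI[of _ I]) (auto simp: PiE_def)
    qed
    show "(\<lambda>f. \<lambda>i\<in>I. restrict f (?A i)) ` ?F \<subseteq> ?G"
    proof (rule image_subsetI)
      fix f assume f: "f \<in> ?F"
      then have "f x \<in> ?B (c x)" if "x \<in> A" for x using that by auto
      then have "restrict f (?A i) \<in> ?A i \<rightarrow>\<^sub>E ?B i" for i by auto
      moreover have "inj_on (restrict f (?A i)) (?A i)" for i
      proof -
        have "inj_on f (?A i)" using f by (auto intro: inj_on_subset)
        then show ?thesis by (simp add: inj_on_def)
      qed
      ultimately show "(\<lambda>i\<in>I. restrict f (?A i)) \<in> ?G"
        by (intro restrict_PiE_iff[THEN iffD2]) blast
    qed
    show "(\<lambda>g. \<lambda>x\<in>A. g (c x) x) ` ?G \<subseteq> ?F"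
    proof (rule image_subsetI)
      fix g assume g: "g \<in> ?G"
      have gi: "g i \<in> ?A i \<rightarrow>\<^sub>E ?B i" "inj_on (g i) (?A i)" if "i \<in> I" for i
        using PiE_mem[OF g that] by auto
      have val: "g (c x) x \<in> ?B (c x)" if "x \<in> A" for x
        using PiE_mem[OF gi(1), of "c x" x] that I(2) by auto
      have "inj_on (\<lambda>x\<in>A. g (c x) x) A"
      proof (rule inj_onI)
        fix x y assume xy: "x \<in> A" "y \<in> A" "(\<lambda>x\<in>A. g (c x) x) x = (\<lambda>x\<in>A. g (c x) x) y"
        then have "c x = c y" using val[of x] val[of y] by auto
        then show "x = y" using gi(2)[of "c x"] I(2) xy by (auto simp: inj_on_def)
      qed
      then show "(\<lambda>x\<in>A. g (c x) x) \<in> ?F" using val by auto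
    qed
  qed
  then have "card ?F = card ?G" by (rule bij_betw_same_card)
  also have "\<dots> = (\<Prod>i\<in>I. fact (card (?A i)))"
    unfolding card_PiE[OF I(1)] using A B eq by (intro prod.cong card_injections_eq_fact) auto
  finally show ?thesis .
qed

section \<open>Permutations that carry a tiling to a tiling\<close>

text \<open>When \<open>S\<close> is the link set of an \<open>r\<close>-tiling, these are the permutations that map each
  of its tiles monotonically onto an \<open>s\<close>-tile.\<close>

definition carrying_perms :: "nat \<Rightarrow> nat \<Rightarrow> nat \<Rightarrow> nat set \<Rightarrow> (nat \<Rightarrow> nat) set" where
  "carrying_perms r s n S = {\<pi>. \<pi> permutes {1..n} \<and> (\<forall>i\<in>S. \<pi> (i + r) = \<pi> i + s)}"

lemma carrying_perm_chain:
  assumes T: "T \<in> tilings r n" and r: "r \<ge> 1" and t: "t \<in> T"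
    and \<pi>: "\<pi> \<in> carrying_perms r s n (links r T)"
  shows "j < card t \<Longrightarrow> \<pi> (Min t + j * r) = \<pi> (Min t) + j * s"
    and "\<pi> ` t = chain s (\<pi> (Min t)) (card t)"
proof -
  note c = tile_eq_chain[OF tilingsD(2)[OF T t] r]
  have mem: "Min t + j * r \<in> t" if "j < card t" for j
    using chain_memI[OF that, of "Min t" r] by (simp flip: c(1))
  show val: "\<pi> (Min t + j * r) = \<pi> (Min t) + j * s" if "j < card t" for j
    using that
  proof (induction j)
    case (Suc j)
    have "Min t + j * r \<in> links r T"
      using mem[of j] mem[of "Suc j"] Suc.prems t by (auto simp: links_def algebra_simps)
    then have "\<pi> (Min t + j * r + r) = \<pi> (Min t + j * r) + s"
      using \<pi> by (auto simp: carrying_perms_def)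
    then show ?case using Suc by (simp add: algebra_simps)
  qed simp
  have "\<pi> ` t = \<pi> ` chain r (Min t) (card t)" by (simp flip: c(1))
  also have "\<dots> = chain s (\<pi> (Min t)) (card t)"
    unfolding chain_def image_image using val by (intro image_cong) auto
  finally show "\<pi> ` t = chain s (\<pi> (Min t)) (card t)" .
qed

lemma carrying_perm_image:
  assumes T: "T \<in> tilings r n" and r: "r \<ge> 1" and \<pi>: "\<pi> \<in> carrying_perms r s n (links r T)"
  shows "(`) \<pi> ` T \<in> tilings s n" and "tiling_type ((`) \<pi> ` T) = tiling_type T"
    and "inj_on ((`) \<pi>) T"
proof -
  have perm: "\<pi> permutes {1..n}" using \<pi> by (auto simp: carrying_perms_def)
  then have inj: "inj \<pi>" by (rule permutes_inj)
  have img: "\<pi> ` {1..n} = {1..n}" using perm by (rule permutes_image)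
  show "(`) \<pi> ` T \<in> tilings s n"
  proof (rule tilingsI)
    fix u assume "u \<in> (`) \<pi> ` T"
    then obtain t where t: "t \<in> T" "u = \<pi> ` t" by blast
    show "u \<subseteq> {1..n}" using t tilingsD(1)[OF T] img by blast
    show "is_tile s u"
      using carrying_perm_chain(2)[OF T r t(1) \<pi>] tile_eq_chain(2)[OF tilingsD(2)[OF T t(1)] r] t(2)
      by (auto simp: is_tile_chain)
  next
    fix y assume "y \<in> {1..n}"
    then obtain x where "x \<in> {1..n}" "y = \<pi> x" using img by blast
    moreover from this obtain t where "t \<in> T" "x \<in> t" using tilingsD(3)[OF T] by blast
    ultimately show "\<exists>u\<in>(`) \<pi> ` T. y \<in> u" by blast
  next
    fix t u y assume "t \<in> (`) \<pi> ` T" "u \<in> (`) \<pi> ` T" "y \<in> t" "y \<in> u"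
    then obtain t' u' x x' where tu: "t' \<in> T" "u' \<in> T" "t = \<pi> ` t'" "u = \<pi> ` u'"
      and x: "x \<in> t'" "x' \<in> u'" "y = \<pi> x" "y = \<pi> x'" by blast
    then have "x = x'" using inj by (simp add: inj_eq)
    then show "t = u" using tilingsD(4)[OF T tu(1,2)] tu(3,4) x(1,2) by blast
  qed
  show injT: "inj_on ((`) \<pi>) T"
    using inj by (auto simp: inj_on_def inj_image_eq_iff)
  show "tiling_type ((`) \<pi> ` T) = tiling_type T"
  proof
    fix i
    have "card (\<pi> ` t) = card t" for t
      using inj by (intro card_image) (auto intro: inj_on_subset)
    then have "{u \<in> (`) \<pi> ` T. card u = i} = (`) \<pi> ` {t\<in>T. card t = i}" by auto
    then show "tiling_type ((`) \<pi> ` T) i = tiling_type T i"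
      using injT by (auto simp: tiling_type_def intro!: card_image elim: inj_on_subset)
  qed
qed

text \<open>A tile and its image are progressions of the same length, traversed in the same direction, so
  knowing the image of each tile as a set already fixes the permutation pointwise. Conversely any
  size-preserving matching of the tiles can be filled in by this monotone rule.\<close>

lemma bij_betw_perms_tile_maps:
  assumes T: "T \<in> tilings r n" and U: "U \<in> tilings s n" and r: "r \<ge> 1" and s: "s \<ge> 1"
    and type: "tiling_type U = tiling_type T"
  shows "bij_betw (\<lambda>\<pi>. \<lambda>t\<in>T. \<pi> ` t)
    {\<pi> \<in> carrying_perms r s n (links r T). (`) \<pi> ` T = U}
    {f \<in> PiE T (\<lambda>t. {u\<in>U. card u = card t}). inj_on f T}"
    (is "bij_betw ?\<Phi> ?P ?F")
  unfolding bij_betw_def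
proof (intro conjI inj_onI equalityI subsetI)
  fix \<pi> \<sigma> assume \<pi>: "\<pi> \<in> ?P" and \<sigma>: "\<sigma> \<in> ?P" and eq: "?\<Phi> \<pi> = ?\<Phi> \<sigma>"
  show "\<pi> = \<sigma>"
  proof
    fix x
    show "\<pi> x = \<sigma> x"
    proof (cases "x \<in> {1..n}")
      case True
      then obtain t where t: "t \<in> T" "x \<in> t" using tilingsD(3)[OF T] by blast
      note c = tile_eq_chain[OF tilingsD(2)[OF T t(1)] r]
      have "\<pi> ` t = \<sigma> ` t" using fun_cong[OF eq, of t] t(1) by simp
      then have "Min (chain s (\<pi> (Min t)) (card t)) = Min (chain s (\<sigma> (Min t)) (card t))"
        using carrying_perm_chain(2)[OF T r t(1), of \<pi> s] carrying_perm_chain(2)[OF T r t(1), of \<sigma> s]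
          \<pi> \<sigma> by simp
      then have "\<pi> (Min t) = \<sigma> (Min t)" using c(2) by (simp add: Min_chain)
      moreover obtain j where "j < card t" "x = Min t + j * r"
        using t(2) by (subst (asm) c(1)) (auto elim: chain_memE)
      ultimately show ?thesis
        using carrying_perm_chain(1)[OF T r t(1), of \<pi> s] carrying_perm_chain(1)[OF T r t(1), of \<sigma> s]
          \<pi> \<sigma> by auto
    next
      case False
      then show ?thesis using \<pi> \<sigma> permutes_not_in[of \<pi> "{1..n}" x] permutes_not_in[of \<sigma> "{1..n}" x]
        by (auto simp: carrying_perms_def)
    qed
  qed
next
  fix f assume "f \<in> ?\<Phi> ` ?P"
  then obtain \<pi> where f: "f = ?\<Phi> \<pi>" and \<pi>: "\<pi> \<in> carrying_perms r s n (links r T)" "(`) \<pi> ` T = U"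
    by blast
  have "inj \<pi>" using \<pi> by (auto simp: carrying_perms_def intro: permutes_inj)
  then have "card (\<pi> ` t) = card t" for t
    by (intro card_image) (auto intro: inj_on_subset)
  moreover have "inj_on f T"
    using carrying_perm_image(3)[OF T r \<pi>(1)] by (simp add: f inj_on_def)
  ultimately show "f \<in> ?F" using \<pi>(2) by (auto simp: f)
next
  fix f assume f: "f \<in> ?F"
  then have fU: "f t \<in> U" "card (f t) = card t" if "t \<in> T" for t
    using that by auto
  have finj: "inj_on f T" using f by simp
  \<comment> \<open>Tilings of equal type have equally many tiles, so the injection \<open>f\<close> reaches every tile of \<open>U\<close>.\<close>
  have "card U = card T"
    using sum_tiling_type[OF T] sum_tiling_type[OF U] type by simp
  then have fT: "f ` T = U"
    using fU finj tiling_finite[OF U] by (intro card_subset_eq) (auto simp: card_image)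
  define tile where "tile x = (THE t. t \<in> T \<and> x \<in> t)" for x
  have tile: "tile x = t" if "t \<in> T" "x \<in> t" for t x
    unfolding tile_def
  proof (rule the_equality)
    show "u = t" if "u \<in> T \<and> x \<in> u" for u
      using tilingsD(4)[OF T] that \<open>t \<in> T\<close> \<open>x \<in> t\<close> by metis
  qed (use that in blast)
  \<comment> \<open>Each tile is sent to its prescribed target in increasing order.\<close>
  define \<pi> where "\<pi> x = (if x \<in> {1..n}
    then Min (f (tile x)) + ((x - Min (tile x)) div r) * s else x)" for x
  have val: "\<pi> (Min t + j * r) = Min (f t) + j * s" if t: "t \<in> T" and j: "j < card t" for t j
  proof -
    have "Min t + j * r \<in> t"
      using chain_memI[OF j, of "Min t" r] by (simp flip: tile_eq_chain(1)[OF tilingsD(2)[OF T t] r])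
    then show ?thesis using tile[OF t] tilingsD(1)[OF T t] r by (auto simp: \<pi>_def)
  qed
  have img: "\<pi> ` t = f t" if t: "t \<in> T" for t
  proof -
    note ct = tile_eq_chain(1)[OF tilingsD(2)[OF T t] r]
    note cf = tile_eq_chain(1)[OF tilingsD(2)[OF U fU(1)[OF t]] s]
    have "\<pi> ` t = \<pi> ` chain r (Min t) (card t)" by (simp flip: ct)
    also have "\<dots> = chain s (Min (f t)) (card (f t))"
      unfolding chain_def image_image fU(2)[OF t] using val[OF t] by (intro image_cong) auto
    finally show ?thesis by (simp flip: cf)
  qed
  have "\<pi> ` {1..n} = {1..n}"
  proof -
    have "\<Union>T = {1..n}" "\<Union>U = {1..n}"
      using T U by (auto simp: tilings_def partition_on_def)
    then have "\<pi> ` {1..n} = (\<Union>t\<in>T. \<pi> ` t)" by blast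
    also have "\<dots> = \<Union>U" using img fT by auto
    finally show ?thesis using \<open>\<Union>U = {1..n}\<close> by simp
  qed
  then have "bij_betw \<pi> {1..n} {1..n}"
    by (intro bij_betw_imageI eq_card_imp_inj_on) auto
  then have perm: "\<pi> permutes {1..n}"
    by (rule bij_imp_permutes) (simp only: \<pi>_def if_False)
  have "\<pi> (i + r) = \<pi> i + s" if i: "i \<in> links r T" for i
  proof -
    obtain t where t: "t \<in> T" "i \<in> t" "i + r \<in> t" using i by (auto simp: links_def)
    note c = tile_eq_chain(1)[OF tilingsD(2)[OF T t(1)] r]
    obtain j where j: "j < card t" "i = Min t + j * r"
      using t(2) by (subst (asm) c) (auto elim: chain_memE)
    have "Suc j < card t" using chain_succ_iff[OF r j(1), of "Min t"] t(3) j(2) by (simp flip: c)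
    then show ?thesis using val[OF t(1), of j] val[OF t(1), of "Suc j"] j
      by (simp add: algebra_simps)
  qed
  then have "\<pi> \<in> carrying_perms r s n (links r T)" using perm by (simp add: carrying_perms_def)
  moreover have "(`) \<pi> ` T = U" using img fT by auto
  moreover have "f = ?\<Phi> \<pi>" using f img by (auto simp: fun_eq_iff PiE_def extensional_def)
  ultimately show "f \<in> ?\<Phi> ` ?P" by blast
qed

lemma finite_carrying_perms: "finite (carrying_perms r s n S)"
  by (rule finite_subset[OF _ finite_permutations[of "{1..n}"]]) (auto simp: carrying_perms_def)

text \<open>The factor \<open>\<Prod>i. fact (tiling_type T i)\<close> does not depend on the image tiling \<open>U\<close>, so all fibres of
  \<open>\<pi> \<mapsto> (`) \<pi> ` T\<close> over \<open>s\<close>-tilings of the same type have equal size.\<close>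

lemma card_carrying_perms:
  assumes T: "T \<in> tilings r n" and r: "r \<ge> 1" and s: "s \<ge> 1"
  shows "card (carrying_perms r s n (links r T)) =
    card {U \<in> tilings s n. tiling_type U = tiling_type T} * (\<Prod>i=1..n. fact (tiling_type T i))"
proof -
  let ?C = "carrying_perms r s n (links r T)"
  let ?Us = "{U \<in> tilings s n. tiling_type U = tiling_type T}"
  have fibre: "card {\<pi> \<in> ?C. (`) \<pi> ` T = U} = (\<Prod>i=1..n. fact (tiling_type T i))"
    if U: "U \<in> ?Us" for U
  proof -
    from U have U': "U \<in> tilings s n" and type: "tiling_type U = tiling_type T" by auto
    have "card {\<pi> \<in> ?C. (`) \<pi> ` T = U} =
        card {f \<in> PiE T (\<lambda>t. {u\<in>U. card u = card t}). inj_on f T}"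
      by (rule bij_betw_same_card[OF bij_betw_perms_tile_maps[OF T U' r s type]])
    also have "\<dots> = (\<Prod>i\<in>{1..n}. fact (card {t\<in>T. card t = i}))"
      using tiling_finite[OF T] tiling_finite[OF U'] tile_size[OF T] fun_cong[OF type]
      by (intro card_class_preserving_injections) (auto simp: tiling_type_def)
    finally show ?thesis by (simp add: tiling_type_def)
  qed
  have "card ?C = (\<Sum>\<pi>\<in>?C. 1)" by simp
  also have "\<dots> = (\<Sum>U\<in>?Us. \<Sum>\<pi>\<in>{\<pi> \<in> ?C. (`) \<pi> ` T = U}. 1)"
    using carrying_perm_image(1,2)[OF T r] finite_tilings
    by (intro sum.group[symmetric] finite_carrying_perms) auto
  also have "\<dots> = (\<Sum>U\<in>?Us. \<Prod>i=1..n. fact (tiling_type T i))"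
    using fibre by (intro sum.cong) auto
  finally show ?thesis by simp
qed

section \<open>Inclusion--exclusion\<close>

lemma sum_alternating_Pow:
  assumes "finite A"
  shows "(\<Sum>X\<in>Pow A. (- 1 :: real) ^ card X) = (if A = {} then 1 else 0)"
  using prod_diff_conv_sum[OF assms, of "\<lambda>_. 1 :: real" "\<lambda>_. 1"] assms
  by (auto simp: power_0_left card_eq_0_iff split: if_splits)

lemma card_avoiding_perms:
  "real (card (avoiding_perms r s n)) =
    (\<Sum>S\<in>Pow (steps r n). (- 1) ^ card S * real (card (carrying_perms r s n S)))"
proof -
  let ?P = "{\<pi>. \<pi> permutes {1..n}}"
  define D where "D \<pi> = {i \<in> steps r n. \<pi> (i + r) = \<pi> i + s}" for \<pi> :: "nat \<Rightarrow> nat"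
  have fin: "finite ?P" by (rule finite_permutations) simp
  have Pow: "Pow (D \<pi>) = {S \<in> Pow (steps r n). S \<subseteq> D \<pi>}" for \<pi>
    by (auto simp: D_def)
  have "avoiding_perms r s n = {\<pi> \<in> ?P. D \<pi> = {}}"
    by (auto simp: avoiding_perms_def D_def steps_def)
  then have "real (card (avoiding_perms r s n)) = (\<Sum>\<pi>\<in>?P. if D \<pi> = {} then 1 else 0)"
    using fin by (simp add: sum.If_cases Int_def)
  also have "\<dots> = (\<Sum>\<pi>\<in>?P. \<Sum>S\<in>Pow (D \<pi>). (- 1) ^ card S)"
    using finite_steps[of r n] by (intro sum.cong refl sum_alternating_Pow[symmetric]) (auto simp: D_def)
  also have "\<dots> = (\<Sum>S\<in>Pow (steps r n). \<Sum>\<pi>\<in>{\<pi>\<in>?P. S \<subseteq> D \<pi>}. (- 1) ^ card S)"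
    unfolding Pow using fin finite_steps by (intro sum.swap_restrict) auto
  also have "\<dots> = (\<Sum>S\<in>Pow (steps r n). (- 1) ^ card S * real (card (carrying_perms r s n S)))"
  proof (intro sum.cong refl)
    fix S assume "S \<in> Pow (steps r n)"
    then have "{\<pi>\<in>?P. S \<subseteq> D \<pi>} = carrying_perms r s n S"
      by (auto simp: D_def carrying_perms_def)
    then show "(\<Sum>\<pi>\<in>{\<pi>\<in>?P. S \<subseteq> D \<pi>}. (- 1) ^ card S) =
        (- 1) ^ card S * real (card (carrying_perms r s n S))" by simp
  qed
  finally show ?thesis .
qed

section \<open>The enumeration by tilings\<close>

lemma tiling_coeff_eq:
  assumes "a \<in> int_partitions n"
  shows "tiling_coeff n r a = card {T \<in> tilings r n. tiling_type T = a}"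
proof -
  have "tiling_type T = a" if "T \<in> tilings r n" "\<forall>i\<in>{1..n}. tiling_type T i = a i" for T
  proof
    fix i
    show "tiling_type T i = a i"
      using that assms tiling_type_in_int_partitions[of T r n]
      unfolding int_partitions_def by (cases "i \<in> {1..n}") (blast, simp)
  qed
  then have "{T \<in> tilings r n. \<forall>i\<in>{1..n}. tiling_type T i = a i} =
      {T \<in> tilings r n. tiling_type T = a}" by auto
  then show ?thesis by (simp add: tiling_coeff_def)
qed

theorem mainTheorem1:
  fixes r s n :: nat
  assumes "r \<ge> 1" and "s \<ge> 1" and "n \<ge> 1"
  shows "real (card (avoiding_perms r s n)) =
    (\<Sum>a\<in>int_partitions n.
       real (tiling_coeff n s a) * real (tiling_coeff n r a)
         * (- 1) powi ((\<Sum>i=1..n. int (a i)) - int n)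
         * (\<Prod>i=1..n. fact (a i)))"
proof -
  let ?w = "\<lambda>a. real (tiling_coeff n s a) * (- 1) powi ((\<Sum>i=1..n. int (a i)) - int n)
    * (\<Prod>i=1..n. fact (a i))"
  have summand: "(- 1) ^ card (links r T) * real (card (carrying_perms r s n (links r T))) =
      ?w (tiling_type T)" if T: "T \<in> tilings r n" for T
  proof -
    \<comment> \<open>The exponent is the negative of the number of links; for \<open>- 1\<close> the sign of an exponent is
      irrelevant.\<close>
    have "(\<Sum>i=1..n. int (tiling_type T i)) - int n = - int (card (links r T))"
      using sum_tiling_type[OF T] card_links[OF T assms(1)] by (simp flip: of_nat_sum)
    then have "(- 1 :: real) powi ((\<Sum>i=1..n. int (tiling_type T i)) - int n) =
        (- 1) ^ card (links r T)"
      by (simp add: power_int_minus flip: power_inverse)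
    moreover have "tiling_coeff n s (tiling_type T) =
        card {U \<in> tilings s n. tiling_type U = tiling_type T}"
      by (rule tiling_coeff_eq[OF tiling_type_in_int_partitions[OF T]])
    ultimately show ?thesis
      using card_carrying_perms[OF T assms(1,2)] by (simp add: of_nat_prod)
  qed
  have "real (card (avoiding_perms r s n)) =
      (\<Sum>T\<in>tilings r n. (- 1) ^ card (links r T) * real (card (carrying_perms r s n (links r T))))"
    unfolding card_avoiding_perms
    by (rule sum.reindex_bij_betw[OF bij_betw_links[OF assms(1)], symmetric])
  also have "\<dots> = (\<Sum>T\<in>tilings r n. ?w (tiling_type T))"
    using summand by (intro sum.cong) auto
  also have "\<dots> = (\<Sum>a\<in>int_partitions n. \<Sum>T\<in>{T \<in> tilings r n. tiling_type T = a}. ?w (tiling_type T))"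
    using tiling_type_in_int_partitions
    by (intro sum.group[symmetric] finite_tilings finite_int_partitions) blast
  also have "\<dots> = (\<Sum>a\<in>int_partitions n. real (tiling_coeff n r a) * ?w a)"
    by (intro sum.cong refl) (simp add: tiling_coeff_eq)
  finally show ?thesis by (simp add: mult_ac)
qed

end
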